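(* Let $H$ be a separable infinite-dimensional complex Hilbert space, let $J$ be a two-sided ideal of $B(H)$, and let $\mathscr S \subset J$ be a set of cardinality strictly less than $\mathfrak c$. The algebraic structure of the $J$-ideal $(\mathscr S)_J$ generated by $\mathscr S$ is given by $$(\mathscr S)_J = \operatorname{span}\{\mathscr S + J\mathscr S + \mathscr S J\} + J(\mathscr S)J .$$ Here $J(\mathscr S)J$ is a $B(H)$-ideal, $\operatorname{span}\{J\mathscr S + \mathscr S J\} + J(\mathscr S)J$ is a $J$-ideal, and $$J(\mathscr S)J \subset \operatorname{span}\{J\mathscr S + \mathscr S J\} + J(\mathscr S)J \subset (\mathscr S)_J .$$ These inclusions collapse to $J(\mathscr S)J = (\mathscr S)_J$ if and only if $(\mathscr S)$ is $J$-soft, i.e., $(\mathscr S) = (\mathscr S)J$.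
   Context: $B(H)$ is the algebra of bounded linear operators on $H$, and $\mathfrak c$ is the cardinality of the continuum. A $B(H)$-ideal is a two-sided ideal of $B(H)$ (not necessarily norm-closed). For a $B(H)$-ideal $J$, a $J$-ideal (subideal) is a complex linear subspace $\mathcal I \subset J$ with $AX, XA \in \mathcal I$ for all $A\in J$, $X \in \mathcal I$. For $\mathscr S \subset J$, $(\mathscr S)$ is the smallest $B(H)$-ideal containing $\mathscr S$ and $(\mathscr S)_J$ is the smallest $J$-ideal containing $\mathscr S$. The product $I_1I_2$ of two $B(H)$-ideals is the $B(H)$-ideal of all finite sums $\sum_i A_iB_i$ with $A_i\in I_1$, $B_i\in I_2$ (this product is commutative and associative); in particular $J(\mathscr S)J$ is the product of the three $B(H)$-ideals $J$, $(\mathscr S)$, $J$. A $B(H)$-ideal $I$ is called $J$-soft if $IJ = I$. $J\mathscr S := \{AS \mid A\in J, S\in\mathscr S\}$ and $\mathscr S J := \{SA \mid S\in\mathscr S, A\in J\}$. $\operatorname{span}\{\mathscr S + J\mathscr S + \mathscr S J\}$ and $\operatorname{span}\{J\mathscr S + \mathscr S J\}$ denote the complex linear spans of $\mathscr S\cup J\mathscr S\cup\mathscr S J$ and of $J\mathscr S\cup\mathscr S J$, respectively. *)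

theory Defs
  imports "HOL-Analysis.Analysis" "HOL-Library.Equipollence" "HOL-Library.Set_Algebras"
begin

section \<open>Complex Hilbert spaces\<close>

class complex_vector = real_vector +
  fixes scaleC :: "complex \<Rightarrow> 'a \<Rightarrow> 'a"  (infixr \<open>*\<^sub>C\<close> 75)
  assumes scaleC_add_right: "c *\<^sub>C (x + y) = c *\<^sub>C x + c *\<^sub>C y"
    and scaleC_add_left: "(c + d) *\<^sub>C x = c *\<^sub>C x + d *\<^sub>C x"
    and scaleC_scaleC: "c *\<^sub>C (d *\<^sub>C x) = (c * d) *\<^sub>C x"
    and scaleC_complex_of_real: "complex_of_real r *\<^sub>C x = r *\<^sub>R x"

class complex_normed_vector = complex_vector + real_normed_vector +
  assumes norm_scaleC: "norm (c *\<^sub>C x) = cmod c * norm x"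

text \<open>The inner product is linear in its first argument.\<close>

class complex_inner = complex_normed_vector +
  fixes cinner :: "'a \<Rightarrow> 'a \<Rightarrow> complex"
  assumes cinner_commute: "cinner x y = cnj (cinner y x)"
    and cinner_add_left: "cinner (x + y) z = cinner x z + cinner y z"
    and cinner_scaleC_left: "cinner (c *\<^sub>C x) y = c * cinner x y"
    and cinner_self: "cinner x x = complex_of_real ((norm x)\<^sup>2)"

class complex_hilbert = complex_inner + complete_space

global_interpretation cvs: vector_space "scaleC :: complex \<Rightarrow> 'a \<Rightarrow> 'a::complex_vector"
proof
  show "1 *\<^sub>C x = x" for x :: 'a
    using scaleC_complex_of_real[of 1 x] by simp
qed (simp_all add: scaleC_add_right scaleC_add_left scaleC_scaleC)


section \<open>Bounded operators\<close>

lemma bounded_linear_scaleC: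
  "bounded_linear (\<lambda>x :: 'a::complex_normed_vector. c *\<^sub>C x)"
proof
  show "c *\<^sub>C (r *\<^sub>R x) = r *\<^sub>R (c *\<^sub>C x)" for r and x :: 'a
    by (metis scaleC_complex_of_real scaleC_scaleC mult.commute)
  show "\<exists>K. \<forall>x :: 'a. norm (c *\<^sub>C x) \<le> norm x * K"
    by (intro exI[of _ "cmod c"]) (simp add: norm_scaleC mult.commute)
qed (rule scaleC_add_right)

text \<open>The library type of bounded operators consists of the real-linear ones; it carries the
  pointwise complex structure of its codomain.\<close>

instantiation blinfun :: (real_normed_vector, complex_normed_vector) complex_vector
begin

lift_definition scaleC_blinfun :: "complex \<Rightarrow> ('a \<Rightarrow>\<^sub>L 'b) \<Rightarrow> ('a \<Rightarrow>\<^sub>L 'b)"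
  is "\<lambda>c f x. c *\<^sub>C f x"
  by (rule bounded_linear_compose[OF bounded_linear_scaleC])

instance
  by standard (transfer; simp add: fun_eq_iff scaleC_add_right scaleC_add_left scaleC_scaleC
      scaleC_complex_of_real)+

end

definition BH :: "('a::complex_hilbert \<Rightarrow>\<^sub>L 'a) set" where
  "BH = {T. \<forall>c x. blinfun_apply T (c *\<^sub>C x) = c *\<^sub>C blinfun_apply T x}"


section \<open>Ideals and subideals\<close>

definition subideal :: "('a::complex_hilbert \<Rightarrow>\<^sub>L 'a) set \<Rightarrow> ('a \<Rightarrow>\<^sub>L 'a) set \<Rightarrow> bool" where
  "subideal J I \<longleftrightarrow> I \<subseteq> J \<and> cvs.subspace I \<and>
     (\<forall>A\<in>J. \<forall>X\<in>I. A o\<^sub>L X \<in> I \<and> X o\<^sub>L A \<in> I)"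

definition BH_ideal :: "('a::complex_hilbert \<Rightarrow>\<^sub>L 'a) set \<Rightarrow> bool" where
  "BH_ideal I \<longleftrightarrow> subideal BH I"

definition BH_ideal_gen :: "('a::complex_hilbert \<Rightarrow>\<^sub>L 'a) set \<Rightarrow> ('a \<Rightarrow>\<^sub>L 'a) set" where
  "BH_ideal_gen S = BH_ideal hull S"

definition subideal_gen ::
    "('a::complex_hilbert \<Rightarrow>\<^sub>L 'a) set \<Rightarrow> ('a \<Rightarrow>\<^sub>L 'a) set \<Rightarrow> ('a \<Rightarrow>\<^sub>L 'a) set" where
  "subideal_gen J S = subideal J hull S"

definition op_products ::
    "('a::complex_hilbert \<Rightarrow>\<^sub>L 'a) set \<Rightarrow> ('a \<Rightarrow>\<^sub>L 'a) set \<Rightarrow> ('a \<Rightarrow>\<^sub>L 'a) set" where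
  "op_products U V = {A o\<^sub>L B | A B. A \<in> U \<and> B \<in> V}"

definition ideal_prod ::
    "('a::complex_hilbert \<Rightarrow>\<^sub>L 'a) set \<Rightarrow> ('a \<Rightarrow>\<^sub>L 'a) set \<Rightarrow> ('a \<Rightarrow>\<^sub>L 'a) set" where
  "ideal_prod I1 I2 =
     {\<Sum>i<n. A i o\<^sub>L B i | (n::nat) A B. \<forall>i<n. A i \<in> I1 \<and> B i \<in> I2}"

definition soft :: "('a::complex_hilbert \<Rightarrow>\<^sub>L 'a) set \<Rightarrow> ('a \<Rightarrow>\<^sub>L 'a) set \<Rightarrow> bool" where
  "soft J I \<longleftrightarrow> BH_ideal I \<and> ideal_prod I J = I"

text \<open>The hulls above are intersections; for \<open>S\<close> contained in the ideal \<open>J\<close> these are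
  indeed the smallest ideals containing \<open>S\<close>.\<close>

lemma subideal_Inter:
  assumes "F \<noteq> {}" and "\<And>I. I \<in> F \<Longrightarrow> subideal J I"
  shows "subideal J (\<Inter>F)"
  using assms unfolding subideal_def cvs.subspace_def by blast

lemma subideal_gen_smallest:
  assumes "BH_ideal J" and "S \<subseteq> J"
  shows "subideal J (subideal_gen J S)" and "S \<subseteq> subideal_gen J S"
    and "subideal J I \<Longrightarrow> S \<subseteq> I \<Longrightarrow> subideal_gen J S \<subseteq> I"
proof -
  have "subideal J J"
    using assms(1) unfolding BH_ideal_def subideal_def by blast
  then show "subideal J (subideal_gen J S)"
    unfolding subideal_gen_def hull_def using assms(2) by (intro subideal_Inter) auto
qed (auto simp: subideal_gen_def hull_def)

lemma BH_ideal_BH: "BH_ideal (BH :: ('a::complex_hilbert \<Rightarrow>\<^sub>L 'a) set)"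
proof -
  have "c *\<^sub>C d *\<^sub>C x = d *\<^sub>C c *\<^sub>C x" for c d and x :: 'a
    by (simp add: mult.commute)
  then show ?thesis
    unfolding BH_ideal_def subideal_def cvs.subspace_def BH_def
    by (auto simp: blinfun.add_left scaleC_add_right scaleC_blinfun.rep_eq)
qed

lemma BH_ideal_gen_smallest:
  assumes "S \<subseteq> BH"
  shows "BH_ideal (BH_ideal_gen S)" and "S \<subseteq> BH_ideal_gen S"
    and "BH_ideal I \<Longrightarrow> S \<subseteq> I \<Longrightarrow> BH_ideal_gen S \<subseteq> I"
proof -
  have eq: "BH_ideal_gen S = subideal_gen BH S"
    by (simp add: BH_ideal_gen_def subideal_gen_def hull_def BH_ideal_def)
  show "BH_ideal (BH_ideal_gen S)" and "S \<subseteq> BH_ideal_gen S"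
    and "BH_ideal I \<Longrightarrow> S \<subseteq> I \<Longrightarrow> BH_ideal_gen S \<subseteq> I"
    using subideal_gen_smallest[OF BH_ideal_BH assms] unfolding eq BH_ideal_def by blast+
qed

end

theory Submission
  imports Defs
begin

text \<open>Everything except the softness criterion follows by multiplying out; the only inclusion to
  note is \<open>J(S)J \<subseteq> (S)\<^sub>J\<close>, which holds because \<open>A(CsD)B = ((AC)s)(DB)\<close> with \<open>AC, DB \<in> J\<close>. If
  \<open>J(S)J = (S)\<^sub>J\<close> then \<open>(S) = J(S)J \<subseteq> (S)J\<close>. Conversely, \<open>(S) = (S)J\<close> gives \<open>J(S)J = (S)\<close> once
  products of ideals are known to commute. This follows by taking adjoints, since every ideal is
  self-adjoint: if \<open>R\<close> is a self-adjoint root of \<open>T\<^sup>*T\<close>, then \<open>\<parallel>R x\<parallel> = \<parallel>T x\<parallel>\<close>, and Douglas'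
  factorization yields \<open>T\<^sup>* = R W\<close> and \<open>R = V T\<close>.\<close>

section \<open>The inner product\<close>

instance complex_hilbert \<subseteq> banach ..

lemma cinner_add_right: "cinner x (y + z) = cinner x y + cinner x z"
  for x :: "'a::complex_inner"
  by (metis cinner_add_left cinner_commute complex_cnj_add)

lemma cinner_scaleC_right: "cinner x (c *\<^sub>C y) = cnj c * cinner x y"
  for x :: "'a::complex_inner"
  by (metis cinner_scaleC_left cinner_commute complex_cnj_mult)

lemma cinner_scaleR_left: "cinner (r *\<^sub>R x) y = r *\<^sub>R cinner x y"
  for x :: "'a::complex_inner"
  by (metis cinner_scaleC_left scaleC_complex_of_real scaleR_conv_of_real)

lemma cinner_scaleR_right: "cinner x (r *\<^sub>R y) = r *\<^sub>R cinner x y"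
  for x :: "'a::complex_inner"
  by (metis cinner_commute cinner_scaleR_left complex_cnj_scaleR)

lemma power2_norm_add: "(norm (x + y))\<^sup>2 = (norm x)\<^sup>2 + 2 * Re (cinner x y) + (norm y)\<^sup>2"
  for x :: "'a::complex_inner"
proof -
  have "complex_of_real ((norm (x + y))\<^sup>2) =
      of_real ((norm x)\<^sup>2) + (cinner x y + cnj (cinner x y)) + of_real ((norm y)\<^sup>2)"
    unfolding cinner_self[symmetric] cinner_add_left cinner_add_right
    using cinner_commute[of y x] by (simp add: cinner_self)
  then show ?thesis
    unfolding complex_add_cnj by (metis of_real_add of_real_eq_iff)
qed

text \<open>The triangle inequality belongs to the normed structure, so squaring it and cancelling
  the square terms of \<open>power2_norm_add\<close> leaves exactly this form of
  Cauchy-Schwarz.\<close>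

lemma Re_cinner_le: "Re (cinner x y) \<le> norm x * norm y"
  for x :: "'a::complex_inner"
proof -
  have "norm (x + y) ^ 2 \<le> (norm x + norm y) ^ 2"
    by (intro power_mono norm_triangle_ineq) simp
  then show ?thesis
    unfolding power2_norm_add by (simp add: power2_sum)
qed

lemma norm_cinner_le: "cmod (cinner x y) \<le> norm x * norm y"
  for x :: "'a::complex_inner"
proof (cases "cinner x y = 0")
  case False
  \<comment> \<open>A unimodular factor that rotates \<open>cinner x y\<close> onto the nonnegative
    real axis, which reduces the modulus to the real part.\<close>
  define u where "u = cnj (cinner x y) / cmod (cinner x y)"
  have u: "cmod u = 1"
    using False by (simp add: u_def norm_divide)
  have "cnj (cinner x y) * cinner x y = of_real (cmod (cinner x y)) * of_real (cmod (cinner x y))"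
    using complex_norm_square[of "cinner x y"] by (simp add: power2_eq_square mult.commute)
  then have "u * cinner x y = cmod (cinner x y)"
    using False by (simp add: u_def)
  then have "cmod (cinner x y) = Re (cinner (u *\<^sub>C x) y)"
    by (simp add: cinner_scaleC_left)
  also have "\<dots> \<le> norm (u *\<^sub>C x) * norm y"
    by (rule Re_cinner_le)
  finally show ?thesis
    by (simp add: norm_scaleC u)
qed simp

interpretation cinner: bounded_bilinear "cinner :: 'a::complex_inner \<Rightarrow> 'a \<Rightarrow> complex"
proof
  show "\<exists>K. \<forall>a b :: 'a. norm (cinner a b) \<le> norm a * norm b * K"
    using norm_cinner_le by (intro exI[of _ 1]) auto
qed (simp_all add: cinner_add_left cinner_add_right cinner_scaleR_left cinner_scaleR_right)

lemma cinner_extensional: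
  assumes "\<And>x :: 'a::complex_inner. cinner x y = cinner x z"
  shows "y = z"
proof -
  have "cinner (y - z) (y - z) = 0"
    using assms[of "y - z"] by (simp add: cinner.diff_right)
  then show ?thesis
    by (simp add: cinner_self)
qed


interpretation blinfun_compose: bounded_bilinear
  "blinfun_compose :: ('b::real_normed_vector \<Rightarrow>\<^sub>L 'c::real_normed_vector) \<Rightarrow>
    ('a::real_normed_vector \<Rightarrow>\<^sub>L 'b) \<Rightarrow> _"
  by (rule bounded_bilinear_blinfun_compose)

lemma blinfun_compose_assoc: "(A o\<^sub>L B) o\<^sub>L C = A o\<^sub>L (B o\<^sub>L C)"
  by (rule blinfun_eqI) simp


section \<open>Adjoints and factorization\<close>

lemma BH_D: "T \<in> BH \<Longrightarrow> blinfun_apply T (c *\<^sub>C x) = c *\<^sub>C blinfun_apply T x"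
  by (simp add: BH_def)

text \<open>The vector \<open>w\<close> is the limit of \<open>A x\<close> along a minimizing sequence of
  \<open>\<parallel>A x\<parallel>\<^sup>2 - 2 Re \<langle>B x, y\<rangle>\<close>, which is Cauchy by the parallelogram law.\<close>

lemma range_closure_representation:
  fixes A B :: "'a::complex_hilbert \<Rightarrow>\<^sub>L 'a"
  assumes A: "A \<in> BH" and B: "B \<in> BH"
    and le: "\<And>x. norm (B x) \<le> K * norm (A x)"
  shows "\<exists>w \<in> closure (range (blinfun_apply A)). \<forall>x. cinner (A x) w = cinner (B x) y"
proof -
  define F where "F x = (norm (A x))\<^sup>2 - 2 * Re (cinner (B x) y)" for x
  have F_bound: "- (K * norm y)\<^sup>2 \<le> F x" for x
  proof -
    have "Re (cinner (B x) y) \<le> norm (B x) * norm y"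
      by (rule Re_cinner_le)
    also have "\<dots> \<le> K * norm (A x) * norm y"
      by (intro mult_right_mono le) simp
    finally have "F x \<ge> (norm (A x))\<^sup>2 - 2 * (K * norm (A x) * norm y)"
      by (simp add: F_def)
    \<comment> \<open>Completing the square: the lower bound just obtained is this square minus
      \<open>(K * norm y)\<^sup>2\<close>.\<close>
    moreover have "(norm (A x) - K * norm y)\<^sup>2 \<ge> 0"
      by simp
    ultimately show ?thesis
      by (simp add: power2_diff algebra_simps)
  qed
  then have bdd: "bdd_below (range F)"
    by (intro bdd_belowI[of _ "- (K * norm y)\<^sup>2"]) auto
  define m where "m = Inf (range F)"
  have m_le: "m \<le> F x" for x
    unfolding m_def using bdd by (simp add: cInf_lower)
  have "\<exists>x. F x < m + 1 / Suc n" for n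
    using cInf_lessD[of "range F" "m + 1 / Suc n"] by (auto simp: m_def)
  then obtain u where u: "\<And>n. F (u n) < m + 1 / Suc n"
    by metis
  have F_lim: "(\<lambda>n. F (u n)) \<longlonglongrightarrow> m"
  proof (rule tendsto_sandwich[of "\<lambda>_. m"])
    show "(\<lambda>n. m + 1 / Suc n) \<longlonglongrightarrow> m"
      using LIMSEQ_inverse_real_of_nat_add[of m] by (simp add: inverse_eq_divide)
  qed (use m_le u in \<open>auto intro: less_imp_le always_eventually\<close>)
  \<comment> \<open>Two near-minimizers have nearby images: the parallelogram law is combined with
    \<open>m \<le> F\<close> at the midpoint of \<open>x\<close> and \<open>z\<close>.\<close>
  have para: "(norm (A x - A z))\<^sup>2 \<le> 2 * (F x - m) + 2 * (F z - m)" for x z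
  proof -
    have half: "A ((1/2) *\<^sub>R (x + z)) = (1/2) *\<^sub>R (A x + A z)"
      "B ((1/2) *\<^sub>R (x + z)) = (1/2) *\<^sub>R (B x + B z)"
      by (simp_all add: blinfun.scaleR_right blinfun.add_right)
    have "4 * F ((1/2) *\<^sub>R (x + z)) = (norm (A x + A z))\<^sup>2 - 4 * Re (cinner (B x) y + cinner (B z) y)"
      unfolding F_def half
      by (simp add: cinner.scaleR_left cinner.add_left power_mult_distrib power2_eq_square
          add_divide_distrib)
    moreover have "(norm (A x - A z))\<^sup>2 + (norm (A x + A z))\<^sup>2 = 2 * (norm (A x))\<^sup>2 + 2 * (norm (A z))\<^sup>2"
      using power2_norm_add[of "A x" "A z"] power2_norm_add[of "A x" "- A z"]
      by (simp add: cinner.minus_right)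
    ultimately show ?thesis
      using m_le[of "(1/2) *\<^sub>R (x + z)"] by (simp add: F_def)
  qed
  have "Cauchy (\<lambda>n. A (u n))"
  proof (rule metric_CauchyI)
    fix e :: real assume "e > 0"
    \<comment> \<open>Both excesses over \<open>m\<close> will be below \<open>q\<close>, so
      \<open>para\<close> bounds the squared distance by \<open>2 * q + 2 * q\<close>, which is the
      square of \<open>e\<close>.\<close>
    define q where "q = e\<^sup>2 / 4"
    have q: "e\<^sup>2 = 4 * q"
      by (simp add: q_def)
    have "\<forall>\<^sub>F n in sequentially. F (u n) < m + q"
      by (intro order_tendstoD(2)[OF F_lim]) (use \<open>e > 0\<close> in \<open>simp add: q_def\<close>)
    then obtain N where N: "\<And>n. n \<ge> N \<Longrightarrow> F (u n) < m + q"
      by (auto simp: eventually_sequentially)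
    show "\<exists>M. \<forall>k\<ge>M. \<forall>n\<ge>M. dist (A (u k)) (A (u n)) < e"
    proof (intro exI[of _ N] allI impI)
      fix k n assume "N \<le> k" "N \<le> n"
      have "(norm (A (u k) - A (u n)))\<^sup>2 < e\<^sup>2"
        using para[of "u k" "u n"] N[OF \<open>N \<le> k\<close>] N[OF \<open>N \<le> n\<close>] q by argo
      then show "dist (A (u k)) (A (u n)) < e"
        unfolding dist_norm using \<open>e > 0\<close> by (meson less_imp_le power_less_imp_less_base)
    qed
  qed
  then obtain w where w: "(\<lambda>n. A (u n)) \<longlonglongrightarrow> w"
    using Cauchy_convergent convergentD by blast
  have Re_eq: "Re (cinner (A x) w) = Re (cinner (B x) y)" for x
  proof -
    define d where "d = Re (cinner (A x) w) - Re (cinner (B x) y)"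
    \<comment> \<open>First variation: perturb the minimizing sequence to
      \<open>t *\<^sub>R x + u n\<close> and let \<open>n\<close> tend to infinity. The linear
      coefficient of a nonnegative quadratic in \<open>t\<close> without constant term must
      vanish.\<close>
    have nonneg: "2 * t * d + t\<^sup>2 * (norm (A x))\<^sup>2 \<ge> 0" for t
    proof -
      have "F (u n) + 2 * t * (Re (cinner (A x) (A (u n))) - Re (cinner (B x) y))
          + t\<^sup>2 * (norm (A x))\<^sup>2 = F (t *\<^sub>R x + u n)" for n
        using power2_norm_add[of "t *\<^sub>R A x" "A (u n)"]
        by (simp add: F_def blinfun.add_right blinfun.scaleR_right cinner.add_left
            cinner.scaleR_left power_mult_distrib algebra_simps)
      then have "m \<le> F (u n) + 2 * t * (Re (cinner (A x) (A (u n))) - Re (cinner (B x) y))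
          + t\<^sup>2 * (norm (A x))\<^sup>2" for n
        using m_le by simp
      moreover have "(\<lambda>n. F (u n) + 2 * t * (Re (cinner (A x) (A (u n))) - Re (cinner (B x) y))
          + t\<^sup>2 * (norm (A x))\<^sup>2) \<longlonglongrightarrow> m + 2 * t * d + t\<^sup>2 * (norm (A x))\<^sup>2"
        unfolding d_def by (intro tendsto_intros F_lim w cinner.tendsto)
      ultimately have "m \<le> m + 2 * t * d + t\<^sup>2 * (norm (A x))\<^sup>2"
        by (intro LIMSEQ_le_const) auto
      then show ?thesis
        by simp
    qed
    have "d = 0"
    proof (rule ccontr)
      assume "d \<noteq> 0"
      \<comment> \<open>The added 1 keeps \<open>c\<close> positive even when
        \<open>A x = 0\<close>; at \<open>t = - d / c\<close> the linear term then outweighs the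
        quadratic one.\<close>
      define c where "c = (norm (A x))\<^sup>2 + 1"
      have c: "c > 0" "(norm (A x))\<^sup>2 < 2 * c"
        unfolding c_def using zero_le_power2[of "norm (A x)"] by argo+
      have "2 * (- d / c) * d + (- d / c)\<^sup>2 * (norm (A x))\<^sup>2
          = (d / c)\<^sup>2 * ((norm (A x))\<^sup>2 - 2 * c)"
        using c by (simp add: field_simps power2_eq_square)
      also have "\<dots> < 0"
        using c \<open>d \<noteq> 0\<close> by (intro mult_pos_neg) auto
      finally show False
        using nonneg[of "- d / c"] by simp
    qed
    then show ?thesis
      by (simp add: d_def)
  qed
  \<comment> \<open>By complex linearity of \<open>A\<close> and \<open>B\<close>, the real-part
    identity at \<open>\<i> *\<^sub>C x\<close> supplies the imaginary parts.\<close>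
  have "cinner (A x) w = cinner (B x) y" for x
    using Re_eq[of x] Re_eq[of "\<i> *\<^sub>C x"]
    by (simp add: BH_D[OF A] BH_D[OF B] cinner_scaleC_left complex_eq_iff)
  moreover have "w \<in> closure (range (blinfun_apply A))"
    using w unfolding closure_sequential by (intro exI[of _ "\<lambda>n. A (u n)"]) simp
  ultimately show ?thesis
    by blast
qed

text \<open>The case \<open>A = 1\<close> yields the adjoint of \<open>B\<close>, and the general case is
  Douglas' factorization \<open>B\<^sup>* = A\<^sup>* W\<close>.\<close>

lemma BH_factorization:
  fixes A B :: "'a::complex_hilbert \<Rightarrow>\<^sub>L 'a"
  assumes A: "A \<in> BH" and B: "B \<in> BH"
    and K: "0 \<le> K" and le: "\<And>x. norm (B x) \<le> K * norm (A x)"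
  shows "\<exists>W \<in> BH. \<forall>x y. cinner (A x) (W y) = cinner (B x) y"
proof -
  define N where "N = closure (range (blinfun_apply A))"
  obtain f where fN: "\<And>y. f y \<in> N" and f: "\<And>x y. cinner (A x) (f y) = cinner (B x) y"
  proof -
    have "\<exists>w. w \<in> N \<and> (\<forall>x. cinner (A x) w = cinner (B x) y)" for y
      using range_closure_representation[OF A B le, of y] unfolding N_def by blast
    then have "\<exists>f. \<forall>y. f y \<in> N \<and> (\<forall>x. cinner (A x) (f y) = cinner (B x) y)"
      by (intro choice allI)
    then show ?thesis
      using that by blast
  qed
  have N_seq: "\<exists>s. (\<lambda>n. A (s n)) \<longlonglongrightarrow> v" if v: "v \<in> N" for v
  proof -
    obtain t where t: "\<And>n. t n \<in> range (blinfun_apply A)" "t \<longlonglongrightarrow> v"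
      using v unfolding N_def closure_sequential by blast
    then have "A (inv_into UNIV A (t n)) = t n" for n
      by (intro f_inv_into_f)
    then show ?thesis
      using t(2) by (intro exI[of _ "\<lambda>n. inv_into UNIV A (t n)"]) simp
  qed
  have N_I: "v \<in> N" if "(\<lambda>n. A (s n)) \<longlonglongrightarrow> v" for s v
    using that unfolding N_def closure_sequential by (intro exI[of _ "\<lambda>n. A (s n)"]) simp
  \<comment> \<open>Approximating \<open>v - w\<close> by vectors \<open>A (u n)\<close> shows that
    it is orthogonal to itself. Keeping the values of \<open>f\<close> in \<open>N\<close> thus
    determines them uniquely, and linearity of \<open>f\<close> follows from this.\<close>
  have unique: "v = w" if diff: "v - w \<in> N" and eq: "\<And>x. cinner (A x) v = cinner (A x) w" for v w
  proof -
    obtain u where u: "(\<lambda>n. A (u n)) \<longlonglongrightarrow> v - w"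
      using N_seq[OF diff] by blast
    have "(\<lambda>n. cinner (A (u n)) (v - w)) \<longlonglongrightarrow> cinner (v - w) (v - w)"
      by (intro cinner.tendsto u tendsto_const)
    moreover have "cinner (A (u n)) (v - w) = 0" for n
      by (simp add: cinner.diff_right eq)
    ultimately have "cinner (v - w) (v - w) = 0"
      by (simp add: LIMSEQ_const_iff)
    then show ?thesis
      by (simp add: cinner_self)
  qed
  have N_add: "v + w \<in> N" if "v \<in> N" "w \<in> N" for v w
  proof -
    obtain s t where "(\<lambda>n. A (s n)) \<longlonglongrightarrow> v" "(\<lambda>n. A (t n)) \<longlonglongrightarrow> w"
      using N_seq[OF \<open>v \<in> N\<close>] N_seq[OF \<open>w \<in> N\<close>] by blast
    then have "(\<lambda>n. A (s n + t n)) \<longlonglongrightarrow> v + w"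
      unfolding blinfun.add_right by (rule tendsto_add)
    then show ?thesis
      by (rule N_I)
  qed
  have N_scale: "c *\<^sub>C v \<in> N" if "v \<in> N" for c v
  proof -
    obtain s where "(\<lambda>n. A (s n)) \<longlonglongrightarrow> v"
      using N_seq[OF \<open>v \<in> N\<close>] by blast
    then have "(\<lambda>n. A (c *\<^sub>C s n)) \<longlonglongrightarrow> c *\<^sub>C v"
      unfolding BH_D[OF A] by (rule bounded_linear.tendsto[OF bounded_linear_scaleC])
    then show ?thesis
      by (rule N_I)
  qed
  have N_diff: "v - w \<in> N" if "v \<in> N" "w \<in> N" for v w
    using N_add[OF that(1) N_scale[OF that(2), of "-1"]] by (simp add: cvs.scale_minus_left)
  have f_add: "f (y + z) = f y + f z" for y z
    by (intro unique N_diff N_add fN) (simp add: cinner.add_right f)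
  have f_scale: "f (c *\<^sub>C y) = c *\<^sub>C f y" for c y
    by (intro unique N_diff N_scale fN) (simp add: cinner_scaleC_right f)
  \<comment> \<open>Testing the defining identity against \<open>A (s n)\<close>, which tends to
    \<open>f y\<close>, gives a bound on the square of \<open>norm (f y)\<close>, from which one
    factor \<open>norm (f y)\<close> cancels.\<close>
  have f_bound: "norm (f y) \<le> norm y * K" for y
  proof -
    obtain s where s: "(\<lambda>n. A (s n)) \<longlonglongrightarrow> f y"
      using N_seq[OF fN[of y]] by blast
    have "(\<lambda>n. cmod (cinner (A (s n)) (f y))) \<longlonglongrightarrow> cmod (cinner (f y) (f y))"
      by (intro tendsto_norm cinner.tendsto s tendsto_const)
    moreover have "(\<lambda>n. K * norm (A (s n)) * norm y) \<longlonglongrightarrow> K * norm (f y) * norm y"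
      by (intro tendsto_intros s)
    moreover have "cmod (cinner (A (s n)) (f y)) \<le> K * norm (A (s n)) * norm y" for n
      unfolding f using norm_cinner_le[of "B (s n)" y] le[of "s n"]
      by (meson mult_right_mono norm_ge_zero order_trans)
    ultimately have "cmod (cinner (f y) (f y)) \<le> K * norm (f y) * norm y"
      by (intro LIMSEQ_le) auto
    then have le': "norm (f y) * norm (f y) \<le> norm (f y) * (norm y * K)"
      by (simp add: cinner_self power2_eq_square norm_mult mult_ac)
    show ?thesis
      using le' \<open>0 \<le> K\<close> by (cases "f y = 0") (auto simp: mult_le_cancel_left)
  qed
  have "bounded_linear f"
  proof
    show "f (r *\<^sub>R y) = r *\<^sub>R f y" for r y
      using f_scale[of "complex_of_real r" y] by (simp add: scaleC_complex_of_real)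
    show "\<exists>K. \<forall>x. norm (f x) \<le> norm x * K"
      using f_bound by blast
  qed (rule f_add)
  then have "Blinfun f \<in> BH \<and> (\<forall>x y. cinner (A x) (Blinfun f y) = cinner (B x) y)"
    by (simp add: BH_def bounded_linear_Blinfun_apply f f_scale)
  then show ?thesis
    by blast
qed

section \<open>Calculus of adjoints\<close>

lemma id_blinfun_BH: "id_blinfun \<in> BH"
  by (simp add: BH_def)

lemma BH_compose: "A o\<^sub>L B \<in> BH" if "A \<in> BH" "B \<in> BH"
  using that by (simp add: BH_def)

text \<open>Encoded by choice: the value is meaningful for \<open>T\<close> in \<open>BH\<close>,
  where a representing operator exists, and unspecified elsewhere.\<close>

definition adj :: "('a::complex_hilbert \<Rightarrow>\<^sub>L 'a) \<Rightarrow> ('a \<Rightarrow>\<^sub>L 'a)" where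
  "adj T = (SOME W. W \<in> BH \<and> (\<forall>x y. cinner (T x) y = cinner x (W y)))"

lemma
  fixes T :: "'a::complex_hilbert \<Rightarrow>\<^sub>L 'a"
  assumes "T \<in> BH"
  shows adj_BH: "adj T \<in> BH" and cinner_adj: "cinner (T x) y = cinner x (adj T y)"
proof -
  have "\<exists>W. W \<in> BH \<and> (\<forall>x y. cinner (T x) y = cinner x (W y))"
    using BH_factorization[OF id_blinfun_BH assms norm_ge_zero[of T]] norm_blinfun[of T]
    by auto
  then have "adj T \<in> BH \<and> (\<forall>x y. cinner (T x) y = cinner x (adj T y))"
    unfolding adj_def by (rule someI_ex)
  then show "adj T \<in> BH" and "cinner (T x) y = cinner x (adj T y)"
    by blast+
qed

lemma cinner_adj': "cinner (adj T x) y = cinner x (T y)" if "T \<in> BH"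
  by (subst (1 2) cinner_commute) (simp add: cinner_adj[OF that])

lemma adj_eqI:
  fixes A B :: "'a::complex_hilbert \<Rightarrow>\<^sub>L 'a"
  assumes "A \<in> BH" and "\<And>x y. cinner (A x) y = cinner x (B y)"
  shows "adj A = B"
proof (rule blinfun_eqI)
  show "adj A y = B y" for y
    by (rule cinner_extensional) (metis assms cinner_adj)
qed

lemma adj_adj: "adj (adj A) = A" if "A \<in> BH"
  using that by (intro adj_eqI adj_BH cinner_adj')

lemma adj_compose: "adj (A o\<^sub>L B) = adj B o\<^sub>L adj A" if "A \<in> BH" "B \<in> BH"
  using that by (intro adj_eqI BH_compose) (simp_all add: cinner_adj)

lemma BH_subspace: "cvs.subspace (BH :: ('a::complex_hilbert \<Rightarrow>\<^sub>L 'a) set)"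
  using BH_ideal_BH[where 'a = 'a] by (simp add: BH_ideal_def subideal_def)

lemma adj_sum: "adj (\<Sum>i\<in>I. A i) = (\<Sum>i\<in>I. adj (A i))" if "\<And>i. i \<in> I \<Longrightarrow> A i \<in> BH"
proof (rule adj_eqI)
  show "(\<Sum>i\<in>I. A i) \<in> BH"
    using that by (intro cvs.subspace_sum BH_subspace)
qed (simp add: blinfun.sum_left cinner.sum_left cinner.sum_right cinner_adj that)

text \<open>The root is \<open>1 - Y\<close>, where \<open>Y\<close> is the limit of
  \<open>Y\<^sub>n\<^sub>+\<^sub>1 = (Q + Y\<^sub>n\<^sup>2) / 2\<close> with \<open>Q = 1 - T\<^sup>*T\<close>. Since \<open>\<parallel>Q\<parallel> \<le> 1\<close>, the increments are
  dominated by those of the bounded increasing scalar sequence \<open>y\<^sub>n\<^sub>+\<^sub>1 = (1 + y\<^sub>n\<^sup>2) / 2\<close>.\<close>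

lemma selfadjoint_square_root:
  fixes T :: "'a::complex_hilbert \<Rightarrow>\<^sub>L 'a"
  assumes T: "T \<in> BH" and T1: "norm T \<le> 1"
  shows "\<exists>R \<in> BH. adj R = R \<and> R o\<^sub>L R = adj T o\<^sub>L T"
proof -
  define Q where "Q = id_blinfun - (adj T o\<^sub>L T)"
  have Q_apply: "Q x = x - adj T (T x)" for x
    by (simp add: Q_def blinfun.diff_left)
  have T_le: "norm (T x) \<le> norm x" for x
    using norm_blinfun[of T x] T1 by (meson mult_left_le_one_le norm_ge_zero order_trans)
  have adj_le: "norm (adj T x) \<le> norm x" for x
  proof -
    have "(norm (adj T x))\<^sup>2 = Re (cinner (T (adj T x)) x)"
      by (simp add: cinner_adj[OF T] cinner_self)
    also have "\<dots> \<le> norm (T (adj T x)) * norm x"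
      by (rule Re_cinner_le)
    also have "\<dots> \<le> norm (adj T x) * norm x"
      by (intro mult_right_mono T_le) simp
    finally show ?thesis
      by (cases "adj T x = 0") (auto simp: power2_eq_square)
  qed
  \<comment> \<open>Expanding the square of \<open>norm (Q x)\<close> gives a correction
    \<open>- 2 * (norm (T x))\<^sup>2 + (norm (adj T (T x)))\<^sup>2\<close>, which is nonpositive
    because \<open>adj T\<close> is a contraction.\<close>
  have Q_norm: "norm Q \<le> 1"
  proof (rule norm_blinfun_bound)
    fix x
    have "(norm (Q x))\<^sup>2 = (norm x)\<^sup>2 - 2 * Re (cinner x (adj T (T x))) + (norm (adj T (T x)))\<^sup>2"
      using power2_norm_add[of x "- adj T (T x)"] by (simp add: Q_apply cinner.minus_right)
    also have "\<dots> = (norm x)\<^sup>2 - 2 * (norm (T x))\<^sup>2 + (norm (adj T (T x)))\<^sup>2"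
      by (simp add: cinner_adj[OF T, symmetric] cinner_self)
    also have "\<dots> \<le> (norm x)\<^sup>2"
      using power_mono[OF adj_le[of "T x"] norm_ge_zero, of 2] zero_le_power2[of "norm (T x)"]
      by linarith
    finally show "norm (Q x) \<le> 1 * norm x"
      by (simp add: power2_le_iff_abs_le)
  qed simp
  define Y where "Y = rec_nat 0 (\<lambda>_ Z. (1/2) *\<^sub>R (Q + (Z o\<^sub>L Z)))"
  define y :: "nat \<Rightarrow> real" where "y = rec_nat 0 (\<lambda>_ z. (1 + z\<^sup>2) / 2)"
  have Y0: "Y 0 = 0" and Y_Suc: "Y (Suc n) = (1/2) *\<^sub>R (Q + (Y n o\<^sub>L Y n))" for n
    by (simp_all add: Y_def)
  have y0: "y 0 = 0" and y_Suc: "y (Suc n) = (1 + (y n)\<^sup>2) / 2" for n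
    by (simp_all add: y_def)
  have Y_diff_Suc: "Y (Suc m) - Y (Suc n) = (1/2) *\<^sub>R ((Y m o\<^sub>L Y m) - (Y n o\<^sub>L Y n))" for m n
    by (simp add: Y_Suc flip: scaleR_diff_right)
  have y_diff_Suc: "y (Suc m) - y (Suc n) = ((y m)\<^sup>2 - (y n)\<^sup>2) / 2" for m n
    by (simp add: y_Suc flip: diff_divide_distrib)
  have y_nonneg: "0 \<le> y n" and y_le: "y n \<le> 1" for n
    by (induction n) (simp_all add: y0 y_Suc power_le_one)
  have Y_norm: "norm (Y n) \<le> y n" for n
  proof (induction n)
    case (Suc n)
    have "norm (Q + (Y n o\<^sub>L Y n)) \<le> norm Q + norm (Y n) * norm (Y n)"
      using norm_triangle_ineq[of Q "Y n o\<^sub>L Y n"] norm_blinfun_compose[of "Y n" "Y n"] by linarith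
    also have "\<dots> \<le> 1 + (y n)\<^sup>2"
      unfolding power2_eq_square by (intro add_mono Q_norm mult_mono Suc y_nonneg norm_ge_zero)
    finally show ?case
      by (simp add: Y_Suc y_Suc)
  qed (simp add: Y0 y0)
  have step: "norm (Y (Suc n) - Y n) \<le> y (Suc n) - y n" for n
  proof (induction n)
    case 0
    show ?case
      using Q_norm by (simp add: Y_Suc Y0 y_Suc y0)
  next
    case (Suc n)
    let ?D = "Y (Suc n) - Y n" and ?d = "y (Suc n) - y n"
    \<comment> \<open>A difference of squares, split so that the factors need not commute: the
      square of \<open>Y (Suc n)\<close> minus that of \<open>Y n\<close> is
      \<open>Y (Suc n)\<close> times \<open>?D\<close> plus \<open>?D\<close> times
      \<open>Y n\<close>.\<close>
    have "norm ((Y (Suc n) o\<^sub>L ?D) + (?D o\<^sub>L Y n))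
        \<le> norm (Y (Suc n)) * norm ?D + norm ?D * norm (Y n)"
      by (meson add_mono norm_blinfun_compose norm_triangle_ineq order_trans)
    also have "\<dots> \<le> y (Suc n) * ?d + ?d * y n"
      using order_trans[OF norm_ge_zero Suc]
      by (intro add_mono mult_mono Suc Y_norm y_nonneg norm_ge_zero)
    finally have "norm ((Y (Suc n) o\<^sub>L ?D) + (?D o\<^sub>L Y n)) \<le> (y (Suc n))\<^sup>2 - (y n)\<^sup>2"
      by (simp add: algebra_simps power2_eq_square)
    moreover have "Y (Suc (Suc n)) - Y (Suc n) = (1/2) *\<^sub>R ((Y (Suc n) o\<^sub>L ?D) + (?D o\<^sub>L Y n))"
      unfolding Y_diff_Suc by (simp add: blinfun_compose.diff_left blinfun_compose.diff_right)
    ultimately show ?case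
      unfolding y_diff_Suc by simp
  qed
  have y_mono: "incseq y"
    using order_trans[OF norm_ge_zero step] by (intro incseq_SucI) simp
  have Y_diff: "norm (Y n - Y m) \<le> y n - y m" if "m \<le> n" for m n
    using that
  proof (induction n rule: dec_induct)
    case (step n)
    have "norm (Y (Suc n) - Y m) \<le> norm (Y (Suc n) - Y n) + norm (Y n - Y m)"
      using norm_triangle_ineq[of "Y (Suc n) - Y n" "Y n - Y m"] by simp
    then show ?case
      using step.IH \<open>\<And>n. norm (Y (Suc n) - Y n) \<le> y (Suc n) - y n\<close>[of n] by linarith
  qed simp
  obtain L where "y \<longlonglongrightarrow> L"
    using incseq_convergent[OF y_mono, of 1] y_le by blast
  then have y_Cauchy: "Cauchy y"
    by (rule LIMSEQ_imp_Cauchy)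
  have "Cauchy Y"
  proof (rule metric_CauchyI)
    fix e :: real assume "e > 0"
    then obtain N where N: "\<And>m n. m \<ge> N \<Longrightarrow> n \<ge> N \<Longrightarrow> dist (y m) (y n) < e"
      using metric_CauchyD[OF y_Cauchy] by blast
    have "dist (Y m) (Y n) < e" if "m \<ge> N" "n \<ge> N" for m n
    proof (cases "m \<le> n")
      case True
      then show ?thesis
        using Y_diff[of m n] N[OF that] by (simp add: dist_norm norm_minus_commute)
    next
      case False
      then show ?thesis
        using Y_diff[of n m] N[OF that] by (simp add: dist_norm)
    qed
    then show "\<exists>M. \<forall>m\<ge>M. \<forall>n\<ge>M. dist (Y m) (Y n) < e"
      by blast
  qed
  then obtain Z where Z: "Y \<longlonglongrightarrow> Z"
    using Cauchy_convergent convergentD by blast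
  have Z_apply: "(\<lambda>n. Y n x) \<longlonglongrightarrow> Z x" for x
    by (intro blinfun.tendsto Z tendsto_const)
  have "(\<lambda>n. Y (Suc n)) \<longlonglongrightarrow> (1/2) *\<^sub>R (Q + (Z o\<^sub>L Z))"
    unfolding Y_Suc
    by (intro tendsto_intros blinfun_compose.tendsto Z)
  then have Z_eq: "Z = (1/2) *\<^sub>R (Q + (Z o\<^sub>L Z))"
    using LIMSEQ_unique[OF LIMSEQ_Suc[OF Z]] by blast
  have Q_BH: "Q \<in> BH"
    unfolding Q_def by (intro cvs.subspace_diff BH_subspace id_blinfun_BH BH_compose adj_BH T)
  have Y_BH: "Y n \<in> BH" for n
  proof (induction n)
    case (Suc n)
    then show ?case
      unfolding Y_Suc scaleC_complex_of_real[symmetric]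
      by (intro cvs.subspace_scale cvs.subspace_add BH_subspace Q_BH BH_compose)
  qed (simp add: Y0 cvs.subspace_0[OF BH_subspace])
  have Z_BH: "Z \<in> BH"
    unfolding BH_def
  proof safe
    show "Z (c *\<^sub>C x) = c *\<^sub>C Z x" for c x
      using Z_apply[of "c *\<^sub>C x"] bounded_linear.tendsto[OF bounded_linear_scaleC Z_apply[of x], of c]
      unfolding BH_D[OF Y_BH] by (rule LIMSEQ_unique)
  qed
  have Q_sa: "cinner (Q x) z = cinner x (Q z)" for x z
    by (simp add: Q_apply cinner.diff_left cinner.diff_right cinner_adj'[OF T] cinner_adj[OF T])
  have Y_sa: "cinner (Y n x) z = cinner x (Y n z)" for n x z
    by (induction n arbitrary: x z)
      (simp_all add: Y0 Y_Suc cinner.zero_left cinner.zero_right blinfun.add_left blinfun.scaleR_left cinner.scaleR_left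
        cinner.scaleR_right cinner.add_left cinner.add_right Q_sa)
  have Z_sa: "cinner (Z x) z = cinner x (Z z)" for x z
  proof (rule LIMSEQ_unique)
    show "(\<lambda>n. cinner (Y n x) z) \<longlonglongrightarrow> cinner (Z x) z"
      by (intro cinner.tendsto Z_apply tendsto_const)
    show "(\<lambda>n. cinner (Y n x) z) \<longlonglongrightarrow> cinner x (Z z)"
      unfolding Y_sa by (intro cinner.tendsto Z_apply tendsto_const)
  qed
  let ?R = "id_blinfun - Z"
  have R_BH: "?R \<in> BH"
    by (intro cvs.subspace_diff BH_subspace id_blinfun_BH Z_BH)
  moreover have "adj ?R = ?R"
    by (intro adj_eqI R_BH) (simp add: blinfun.diff_left cinner.diff_left cinner.diff_right Z_sa)
  \<comment> \<open>The fixed point equation says \<open>2 Z = Q + Z Z\<close>, hence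
    \<open>(1 - Z)(1 - Z) = 1 - 2 Z + Z Z = 1 - Q\<close>.\<close>
  moreover have "?R o\<^sub>L ?R = adj T o\<^sub>L T"
  proof (rule blinfun_eqI)
    fix x
    have "Z x + Z x = x - adj T (T x) + Z (Z x)"
      using arg_cong[OF Z_eq, of "\<lambda>X. 2 *\<^sub>R blinfun_apply X x"]
      by (simp add: blinfun.scaleR_left blinfun.add_left Q_apply scaleR_2)
    then show "(?R o\<^sub>L ?R) x = (adj T o\<^sub>L T) x"
      by (simp add: blinfun.diff_left blinfun.diff_right algebra_simps)
  qed
  ultimately show ?thesis
    by blast
qed

text \<open>Both \<open>T\<close> and the root \<open>R\<close> of \<open>T\<^sup>*T\<close> satisfy \<open>\<parallel>T x\<parallel> = \<parallel>R x\<parallel>\<close>, so each is a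
  left multiple of the other; conjugating one factorization gives \<open>T\<^sup>* = R W\<close>.\<close>

lemma adj_two_sided_multiple:
  fixes T :: "'a::complex_hilbert \<Rightarrow>\<^sub>L 'a"
  assumes T: "T \<in> BH" and T1: "norm T \<le> 1"
  shows "\<exists>V\<in>BH. \<exists>W\<in>BH. adj T = V o\<^sub>L T o\<^sub>L W"
proof -
  obtain R where R: "R \<in> BH" and R_sa: "adj R = R" and sq: "R o\<^sub>L R = adj T o\<^sub>L T"
    using selfadjoint_square_root[OF assms] by blast
  have "complex_of_real ((norm (R x))\<^sup>2) = complex_of_real ((norm (T x))\<^sup>2)" for x
    using arg_cong[OF sq, of "\<lambda>X. cinner x (blinfun_apply X x)"]
    by (simp add: cinner_adj[OF R, unfolded R_sa, symmetric] cinner_adj[OF T, symmetric] cinner_self)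
  then have norm_eq: "norm (R x) = norm (T x)" for x
    by (metis norm_ge_zero of_real_eq_iff power2_eq_imp_eq)
  obtain W where W: "W \<in> BH" "\<And>x y. cinner (R x) (W y) = cinner (T x) y"
    using BH_factorization[OF R T, of 1] norm_eq by auto
  obtain V where V: "V \<in> BH" "\<And>x y. cinner (T x) (V y) = cinner (R x) y"
    using BH_factorization[OF T R, of 1] norm_eq by auto
  have "adj T = R o\<^sub>L W"
    by (intro adj_eqI T) (simp add: W(2)[symmetric] cinner_adj[OF R] R_sa)
  moreover have "R = adj V o\<^sub>L T"
  proof -
    have "adj R = adj T o\<^sub>L V"
      by (intro adj_eqI R) (simp add: V(2)[symmetric] cinner_adj[OF T])
    then have "adj (adj R) = adj (adj T o\<^sub>L V)"
      by simp
    then show ?thesis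
      by (simp add: adj_adj R T V(1) adj_compose adj_BH)
  qed
  ultimately show ?thesis
    using adj_BH[OF V(1)] W(1) by blast
qed


section \<open>Ideals of bounded operators\<close>

lemma blinfun_compose_scaleC_left: "(c *\<^sub>C A) o\<^sub>L B = c *\<^sub>C (A o\<^sub>L B)"
  for A :: "'b::real_normed_vector \<Rightarrow>\<^sub>L 'c::complex_normed_vector"
  by (rule blinfun_eqI) (simp add: scaleC_blinfun.rep_eq)

text \<open>A general element of the operator type is only real-linear; membership in
  \<open>BH\<close> lets the complex scalar pass through \<open>A\<close>.\<close>

lemma blinfun_compose_scaleC_right: "A o\<^sub>L (c *\<^sub>C B) = c *\<^sub>C (A o\<^sub>L B)" if "A \<in> BH"
  by (rule blinfun_eqI) (simp add: scaleC_blinfun.rep_eq BH_D[OF that])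

lemma
  assumes "BH_ideal I"
  shows BH_ideal_subset: "I \<subseteq> BH"
    and BH_ideal_subspace: "cvs.subspace I"
    and BH_ideal_left: "\<And>A X. A \<in> BH \<Longrightarrow> X \<in> I \<Longrightarrow> A o\<^sub>L X \<in> I"
    and BH_ideal_right: "\<And>A X. A \<in> BH \<Longrightarrow> X \<in> I \<Longrightarrow> X o\<^sub>L A \<in> I"
  using assms by (auto simp: BH_ideal_def subideal_def)

lemma BH_ideal_adj:
  assumes I: "BH_ideal I" and T: "T \<in> I"
  shows "adj T \<in> I"
proof -
  \<comment> \<open>Rescaling to a contraction, as \<open>adj_two_sided_multiple\<close> requires;
    the added 1 keeps the divisor positive for \<open>T = 0\<close>.\<close>
  define c where "c = norm T + 1"
  have c: "c > 0" "norm T \<le> c"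
    by (simp_all add: c_def add_nonneg_pos)
  define T' where "T' = (1 / c) *\<^sub>R T"
  have T': "T' \<in> I"
    unfolding T'_def scaleC_complex_of_real[symmetric] by (intro cvs.subspace_scale BH_ideal_subspace I T)
  then have T'_BH: "T' \<in> BH"
    using BH_ideal_subset[OF I] by blast
  have "norm T' \<le> 1"
    using c by (simp add: T'_def)
  then obtain V W where "V \<in> BH" "W \<in> BH" "adj T' = V o\<^sub>L T' o\<^sub>L W"
    using adj_two_sided_multiple[OF T'_BH] by blast
  then have "adj T' \<in> I"
    using BH_ideal_left[OF I] BH_ideal_right[OF I] T' by metis
  then have "complex_of_real c *\<^sub>C adj T' \<in> I"
    by (intro cvs.subspace_scale BH_ideal_subspace I)
  moreover have "adj T = complex_of_real c *\<^sub>C adj T'"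
  proof (rule adj_eqI)
    show "T \<in> BH"
      using BH_ideal_subset[OF I] T by blast
    show "cinner (T x) y = cinner x ((complex_of_real c *\<^sub>C adj T') y)" for x y
    proof -
      have "T x = c *\<^sub>R T' x"
        using c by (simp add: T'_def blinfun.scaleR_left)
      then show ?thesis
        by (simp add: scaleC_complex_of_real blinfun.scaleR_left cinner.scaleR_left
            cinner.scaleR_right cinner_adj[OF T'_BH])
    qed
  qed
  ultimately show ?thesis
    by simp
qed

section \<open>Products of ideals\<close>

lemma ideal_prodE:
  assumes "X \<in> ideal_prod U V"
  obtains A B and n :: nat where "X = (\<Sum>i<n. A i o\<^sub>L B i)" "\<forall>i<n. A i \<in> U \<and> B i \<in> V"
  using assms unfolding ideal_prod_def by blast

lemma ideal_prod_eq_span: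
  assumes "cvs.subspace U" and U: "U \<subseteq> BH"
  shows "ideal_prod U V = cvs.span (op_products U V)"
proof
  show "ideal_prod U V \<subseteq> cvs.span (op_products U V)"
  proof
    fix X assume "X \<in> ideal_prod U V"
    then obtain A B and n :: nat where X: "X = (\<Sum>i<n. A i o\<^sub>L B i)" "\<forall>i<n. A i \<in> U \<and> B i \<in> V"
      by (rule ideal_prodE)
    show "X \<in> cvs.span (op_products U V)"
      unfolding X(1) using X(2)
      by (intro cvs.span_sum cvs.span_base) (auto simp: op_products_def)
  qed
next
  show "cvs.span (op_products U V) \<subseteq> ideal_prod U V"
  proof
    fix X assume "X \<in> cvs.span (op_products U V)"
    then show "X \<in> ideal_prod U V"
    proof (induction rule: cvs.span_induct_alt)
      case base
      show ?case
        unfolding ideal_prod_def by (intro CollectI exI[of _ 0]) auto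
    next
      case (step c X Z)
      obtain A B where X: "X = A o\<^sub>L B" "A \<in> U" "B \<in> V"
        using step.hyps unfolding op_products_def by blast
      obtain A' B' and n :: nat where Z: "Z = (\<Sum>i<n. A' i o\<^sub>L B' i)" "\<forall>i<n. A' i \<in> U \<and> B' i \<in> V"
        using step.IH by (rule ideal_prodE)
      \<comment> \<open>The new product is appended at index \<open>n\<close>, with its scalar
        absorbed into the left factor, where \<open>U\<close> is closed under scaling.\<close>
      let ?A = "A'(n := c *\<^sub>C A)" and ?B = "B'(n := B)"
      have "c *\<^sub>C X + Z = (\<Sum>i<Suc n. ?A i o\<^sub>L ?B i)"
        by (simp add: X Z blinfun_compose_scaleC_left add.commute)
      moreover have "\<forall>i<Suc n. ?A i \<in> U \<and> ?B i \<in> V"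
        using X Z assms by (auto simp: less_Suc_eq intro: cvs.subspace_scale)
      ultimately show ?case
        unfolding ideal_prod_def by blast
    qed
  qed
qed

lemma ideal_prod_memI: "A \<in> U \<Longrightarrow> B \<in> V \<Longrightarrow> A o\<^sub>L B \<in> ideal_prod U V"
  unfolding ideal_prod_def
  by (intro CollectI exI[of _ "Suc 0"] exI[of _ "\<lambda>_. A"] exI[of _ "\<lambda>_. B"]) simp

lemma ideal_prod_subset:
  assumes "\<And>A B. A \<in> U \<Longrightarrow> B \<in> V \<Longrightarrow> A o\<^sub>L B \<in> M" and "cvs.subspace M"
  shows "ideal_prod U V \<subseteq> M"
  using assms unfolding ideal_prod_def by (auto intro!: cvs.subspace_sum)

lemma ideal_prod_mono: "U \<subseteq> U' \<Longrightarrow> V \<subseteq> V' \<Longrightarrow> ideal_prod U V \<subseteq> ideal_prod U' V'"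
  unfolding ideal_prod_def by blast

text \<open>Lets closure under multiplication be checked on generators only: if they lie in this
  subspace, so does everything they span.\<close>

lemma compose_left_preimage_subspace:
  "cvs.subspace M \<Longrightarrow> A \<in> BH \<Longrightarrow> cvs.subspace {X. A o\<^sub>L X \<in> M}"
  by (auto simp: cvs.subspace_def blinfun_compose.add_right blinfun_compose_scaleC_right)

lemma compose_right_preimage_subspace:
  "cvs.subspace M \<Longrightarrow> cvs.subspace {X. X o\<^sub>L A \<in> M}"
  for M :: "('a::complex_hilbert \<Rightarrow>\<^sub>L 'a) set"
  by (auto simp: cvs.subspace_def blinfun_compose.add_left blinfun_compose_scaleC_left)

text \<open>A multiplier from the left is absorbed by the first factor of each product, one from the
  right by the second.\<close>

lemma BH_ideal_ideal_prod:
  assumes I1: "BH_ideal I1" and I2: "BH_ideal I2"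
  shows "BH_ideal (ideal_prod I1 I2)"
proof -
  let ?P = "ideal_prod I1 I2"
  have sub: "cvs.subspace ?P"
    by (simp add: ideal_prod_eq_span BH_ideal_subspace BH_ideal_subset I1)
  have "?P \<subseteq> BH"
    using BH_ideal_subset[OF I1] BH_ideal_subset[OF I2]
    by (intro ideal_prod_subset BH_subspace BH_compose) auto
  moreover have "C o\<^sub>L X \<in> ?P \<and> X o\<^sub>L C \<in> ?P" if C: "C \<in> BH" and X: "X \<in> ?P" for C X
  proof -
    have "?P \<subseteq> {X. C o\<^sub>L X \<in> ?P}"
      using BH_ideal_left[OF I1 C]
      by (intro ideal_prod_subset compose_left_preimage_subspace sub C)
        (auto simp: blinfun_compose_assoc[symmetric] intro: ideal_prod_memI)
    moreover have "?P \<subseteq> {X. X o\<^sub>L C \<in> ?P}"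
      using BH_ideal_right[OF I2 C]
      by (intro ideal_prod_subset compose_right_preimage_subspace sub)
        (auto simp: blinfun_compose_assoc intro: ideal_prod_memI)
    ultimately show ?thesis
      using X by blast
  qed
  ultimately show ?thesis
    using sub by (simp add: BH_ideal_def subideal_def)
qed

lemma ideal_prod_left_subset: "BH_ideal I1 \<Longrightarrow> BH_ideal I2 \<Longrightarrow> ideal_prod I1 I2 \<subseteq> I1"
  by (meson BH_ideal_right BH_ideal_subset BH_ideal_subspace ideal_prod_subset subsetD)

lemma ideal_prod_right_subset: "BH_ideal I1 \<Longrightarrow> BH_ideal I2 \<Longrightarrow> ideal_prod I1 I2 \<subseteq> I2"
  by (meson BH_ideal_left BH_ideal_subset BH_ideal_subspace ideal_prod_subset subsetD)

text \<open>The product is itself a self-adjoint ideal, so \<open>adj X\<close> can be decomposed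
  instead of \<open>X\<close>. Taking adjoints again reverses each product, and self-adjointness of
  \<open>I1\<close> and \<open>I2\<close> keeps the factors in their ideals.\<close>

lemma ideal_prod_commute_subset:
  assumes I1: "BH_ideal I1" and I2: "BH_ideal I2"
  shows "ideal_prod I1 I2 \<subseteq> ideal_prod I2 I1"
proof
  fix X assume X: "X \<in> ideal_prod I1 I2"
  have P: "BH_ideal (ideal_prod I1 I2)"
    by (rule BH_ideal_ideal_prod[OF I1 I2])
  obtain A B and n :: nat where AB: "adj X = (\<Sum>i<n. A i o\<^sub>L B i)" "\<forall>i<n. A i \<in> I1 \<and> B i \<in> I2"
    using BH_ideal_adj[OF P X] by (rule ideal_prodE)
  have AB_BH: "A i \<in> BH" "B i \<in> BH" if "i < n" for i
    using AB(2) that BH_ideal_subset[OF I1] BH_ideal_subset[OF I2] by blast+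
  have "X = adj (adj X)"
    using X BH_ideal_subset[OF P] by (simp add: adj_adj subset_iff)
  also have "\<dots> = (\<Sum>i<n. adj (A i o\<^sub>L B i))"
    unfolding AB(1) by (intro adj_sum BH_compose AB_BH) simp_all
  also have "\<dots> = (\<Sum>i<n. adj (B i) o\<^sub>L adj (A i))"
    by (intro sum.cong refl adj_compose AB_BH) simp_all
  also have "\<dots> \<in> ideal_prod I2 I1"
    using AB(2) by (intro cvs.subspace_sum BH_ideal_subspace BH_ideal_ideal_prod ideal_prod_memI
        BH_ideal_adj I1 I2) simp_all
  finally show "X \<in> ideal_prod I2 I1" .
qed

lemma ideal_prod_commute:
  "BH_ideal I1 \<Longrightarrow> BH_ideal I2 \<Longrightarrow> ideal_prod I1 I2 = ideal_prod I2 I1"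
  by (intro equalityI ideal_prod_commute_subset)

section \<open>The generated subideal and the triple product\<close>

text \<open>Common criterion for the two sums in the structure theorem: \<open>P\<close> absorbs
  multipliers by itself, so only the generators \<open>V\<close> have to be tested.\<close>

lemma subideal_span_plus:
  assumes J: "BH_ideal J" and P: "BH_ideal P" "P \<subseteq> J" and V: "V \<subseteq> J"
    and VJ: "\<And>A X. A \<in> J \<Longrightarrow> X \<in> V \<Longrightarrow>
      A o\<^sub>L X \<in> cvs.span V + P \<and> X o\<^sub>L A \<in> cvs.span V + P"
  shows "subideal J (cvs.span V + P)"
proof -
  let ?U = "cvs.span V + P"
  have "?U = {x + y |x y. x \<in> cvs.span V \<and> y \<in> P}"
    by (auto simp: set_plus_def)
  then have sub: "cvs.subspace ?U"
    using cvs.subspace_sums[OF cvs.subspace_span BH_ideal_subspace[OF P(1)]] by simp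
  have P_sub: "P \<subseteq> ?U"
    using set_plus_intro[OF cvs.span_zero[of V]] by fastforce
  have "cvs.span V \<subseteq> J"
    by (intro cvs.span_minimal V BH_ideal_subspace J)
  then have "?U \<subseteq> J"
    using P(2) cvs.subspace_add[OF BH_ideal_subspace[OF J]] by (fastforce elim!: set_plus_elim)
  moreover have "A o\<^sub>L X \<in> ?U \<and> X o\<^sub>L A \<in> ?U" if A: "A \<in> J" and X: "X \<in> ?U" for A X
  proof -
    have A_BH: "A \<in> BH"
      using A BH_ideal_subset[OF J] by blast
    have l: "cvs.span V \<subseteq> {X. A o\<^sub>L X \<in> ?U}"
      using VJ[OF A] by (intro cvs.span_minimal compose_left_preimage_subspace sub A_BH) auto
    have r: "cvs.span V \<subseteq> {X. X o\<^sub>L A \<in> ?U}"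
      using VJ[OF A] by (intro cvs.span_minimal compose_right_preimage_subspace sub) auto
    obtain Y Z where YZ: "X = Y + Z" "Y \<in> cvs.span V" "Z \<in> P"
      using X by (rule set_plus_elim)
    have "A o\<^sub>L Z \<in> ?U" "Z o\<^sub>L A \<in> ?U"
      using BH_ideal_left[OF P(1) A_BH YZ(3)] BH_ideal_right[OF P(1) A_BH YZ(3)] P_sub by blast+
    then show ?thesis
      using l r YZ(2) unfolding YZ(1) blinfun_compose.add_left blinfun_compose.add_right
      by (blast intro: cvs.subspace_add[OF sub])
  qed
  ultimately show ?thesis
    using sub by (simp add: subideal_def)
qed

text \<open>The operators \<open>X\<close> with \<open>J X J\<close> inside the subideal form a
  \<open>BH\<close>-ideal \<open>M\<close>, since a multiplier from \<open>BH\<close> next to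
  \<open>X\<close> is absorbed by the neighbouring factor from \<open>J\<close>. As \<open>M\<close>
  contains \<open>S\<close>, it contains the ideal that \<open>S\<close> generates.\<close>

lemma triple_product_subset_subideal_gen:
  assumes J: "BH_ideal J" and S: "S \<subseteq> J"
  shows "ideal_prod (ideal_prod J (BH_ideal_gen S)) J \<subseteq> subideal_gen J S"
proof -
  let ?K = "subideal_gen J S"
  note J_BH = BH_ideal_subset[OF J]
  have K: "subideal J ?K" and SK: "S \<subseteq> ?K"
    using subideal_gen_smallest[OF J S] by blast+
  then have K_sub: "cvs.subspace ?K"
    by (simp add: subideal_def)
  define M where "M = {X \<in> BH. \<forall>A\<in>J. \<forall>B\<in>J. A o\<^sub>L X o\<^sub>L B \<in> ?K}"
  have "BH_ideal M"
    unfolding BH_ideal_def subideal_def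
  proof (intro conjI ballI)
    show "cvs.subspace M"
      using K_sub BH_subspace J_BH unfolding cvs.subspace_def M_def
      by (auto simp: blinfun_compose.add_left blinfun_compose.add_right
          blinfun_compose_scaleC_left blinfun_compose_scaleC_right subset_iff)
  next
    fix C X :: "'a \<Rightarrow>\<^sub>L 'a" assume C: "C \<in> BH" and X: "X \<in> M"
    have "A o\<^sub>L (C o\<^sub>L X) o\<^sub>L B \<in> ?K" if "A \<in> J" "B \<in> J" for A B
    proof -
      have "(A o\<^sub>L C) o\<^sub>L X o\<^sub>L B \<in> ?K"
        using X that BH_ideal_right[OF J C] by (simp add: M_def)
      then show ?thesis
        by (simp add: blinfun_compose_assoc)
    qed
    then show "C o\<^sub>L X \<in> M"
      using C X by (simp add: M_def BH_compose)
    have "A o\<^sub>L (X o\<^sub>L C) o\<^sub>L B \<in> ?K" if "A \<in> J" "B \<in> J" for A B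
    proof -
      have "A o\<^sub>L X o\<^sub>L (C o\<^sub>L B) \<in> ?K"
        using X that BH_ideal_left[OF J C] by (simp add: M_def)
      then show ?thesis
        by (simp add: blinfun_compose_assoc)
    qed
    then show "X o\<^sub>L C \<in> M"
      using C X by (simp add: M_def BH_compose)
  qed (auto simp: M_def)
  moreover have "S \<subseteq> M"
    using K SK S J_BH unfolding M_def subideal_def by blast
  ultimately have "BH_ideal_gen S \<subseteq> M"
    using BH_ideal_gen_smallest(3)[of S M] S J_BH by blast
  then have "ideal_prod J (BH_ideal_gen S) \<subseteq> {X. X o\<^sub>L B \<in> ?K}" if "B \<in> J" for B
    using that by (intro ideal_prod_subset compose_right_preimage_subspace K_sub) (auto simp: M_def)
  then show ?thesis
    by (intro ideal_prod_subset K_sub) blast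
qed

text \<open>Forward, \<open>J I\<close> lies in \<open>I\<close>, so \<open>I = (J I) J\<close> lies
  in \<open>I J\<close>. Backward, commutativity turns \<open>(J I) J\<close> into
  \<open>(I J) J\<close>, and softness applies twice.\<close>

lemma triple_product_eq_iff_soft:
  assumes J: "BH_ideal J" and I: "BH_ideal I"
  shows "ideal_prod (ideal_prod J I) J = I \<longleftrightarrow> soft J I"
proof
  assume eq: "ideal_prod (ideal_prod J I) J = I"
  have "I \<subseteq> ideal_prod I J"
    using ideal_prod_mono[OF ideal_prod_right_subset[OF J I] subset_refl, of J] eq by simp
  then show "soft J I"
    using ideal_prod_left_subset[OF I J] I by (auto simp: soft_def)
next
  assume "soft J I"
  then show "ideal_prod (ideal_prod J I) J = I"
    using ideal_prod_commute[OF J I] by (simp add: soft_def)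
qed

theorem theorem4p4:
  fixes J S :: "('a::complex_hilbert \<Rightarrow>\<^sub>L 'a) set"
  assumes separable: "\<exists>D :: 'a set. countable D \<and> closure D = UNIV"
    and infinite_dim: "\<nexists>B :: 'a set. finite B \<and> cvs.span B = UNIV"
    and J: "BH_ideal J"
    and S: "S \<subseteq> J"
    and card_S: "S \<prec> (UNIV :: real set)"
  shows "subideal_gen J S =
      cvs.span (S \<union> op_products J S \<union> op_products S J)
        + ideal_prod (ideal_prod J (BH_ideal_gen S)) J
    \<and> BH_ideal (ideal_prod (ideal_prod J (BH_ideal_gen S)) J)
    \<and> subideal J (cvs.span (op_products J S \<union> op_products S J)
        + ideal_prod (ideal_prod J (BH_ideal_gen S)) J)
    \<and> ideal_prod (ideal_prod J (BH_ideal_gen S)) J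
        \<subseteq> cvs.span (op_products J S \<union> op_products S J)
          + ideal_prod (ideal_prod J (BH_ideal_gen S)) J
    \<and> cvs.span (op_products J S \<union> op_products S J)
        + ideal_prod (ideal_prod J (BH_ideal_gen S)) J
        \<subseteq> subideal_gen J S
    \<and> (ideal_prod (ideal_prod J (BH_ideal_gen S)) J = subideal_gen J S
        \<longleftrightarrow> soft J (BH_ideal_gen S))"
proof -
  let ?G = "BH_ideal_gen S" and ?K = "subideal_gen J S"
  let ?P = "ideal_prod (ideal_prod J ?G) J"
  let ?V = "op_products J S \<union> op_products S J"
  let ?W = "S \<union> op_products J S \<union> op_products S J"
  note J_BH = BH_ideal_subset[OF J]
  have S_BH: "S \<subseteq> BH"
    using S J_BH by blast
  have G: "BH_ideal ?G" and SG: "S \<subseteq> ?G"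
    using BH_ideal_gen_smallest[OF S_BH] by blast+
  have K: "subideal J ?K" and SK: "S \<subseteq> ?K"
    using subideal_gen_smallest[OF J S] by blast+
  have K_sub: "cvs.subspace ?K"
    using K by (simp add: subideal_def)
  have JG: "BH_ideal (ideal_prod J ?G)"
    by (rule BH_ideal_ideal_prod[OF J G])
  have P: "BH_ideal ?P"
    by (rule BH_ideal_ideal_prod[OF JG J])
  have PJ: "?P \<subseteq> J"
    by (rule ideal_prod_right_subset[OF JG J])
  have PK: "?P \<subseteq> ?K"
    by (rule triple_product_subset_subideal_gen[OF J S])
  have span_sub: "cvs.span U \<subseteq> cvs.span U + ?P" for U
    using set_plus_intro[OF _ cvs.subspace_0[OF BH_ideal_subspace[OF P]]] by fastforce
  have P_sub: "?P \<subseteq> cvs.span U + ?P" for U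
    using set_plus_intro[OF cvs.span_zero[of U]] by fastforce
  have J_compose: "A o\<^sub>L B \<in> J" if "A \<in> J" "B \<in> J" for A B
    using that J_BH BH_ideal_left[OF J] by blast
  have JSJ: "A o\<^sub>L X o\<^sub>L B \<in> ?P" if "A \<in> J" "X \<in> S" "B \<in> J" for A X B
    using that SG by (intro ideal_prod_memI) auto
  have W_J: "?W \<subseteq> J"
    using S J_compose by (auto simp: op_products_def)
  \<comment> \<open>A multiplier on the outer side of the \<open>J\<close>-factor merges with it; on
    the side of \<open>s\<close> it produces a product in \<open>J S J\<close>, hence in
    \<open>?P\<close>. Stated with a union so that it serves both \<open>?V\<close> and
    \<open>?W\<close>.\<close>
  have V_mult: "A o\<^sub>L X \<in> ?V \<union> ?P \<and> X o\<^sub>L A \<in> ?V \<union> ?P" if A: "A \<in> J" and X: "X \<in> ?V" for A X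
  proof -
    consider B s where "X = B o\<^sub>L s" "B \<in> J" "s \<in> S" | B s where "X = s o\<^sub>L B" "B \<in> J" "s \<in> S"
      using X by (auto simp: op_products_def)
    then show ?thesis
    proof cases
      case 1
      have "A o\<^sub>L X \<in> op_products J S"
        unfolding op_products_def using 1 J_compose[OF A]
        by (metis (mono_tags, lifting) CollectI blinfun_compose_assoc)
      then show ?thesis
        using JSJ[of B s A] 1 A by blast
    next
      case 2
      have "X o\<^sub>L A \<in> op_products S J"
        unfolding op_products_def using 2 J_compose[of _ A] A
        by (metis (mono_tags, lifting) CollectI blinfun_compose_assoc)
      then show ?thesis
        using JSJ[of A s B] 2 A by (simp add: blinfun_compose_assoc)
    qed
  qed
  have sub_V: "subideal J (cvs.span ?V + ?P)"
  proof (rule subideal_span_plus[OF J P PJ])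
    show "A o\<^sub>L X \<in> cvs.span ?V + ?P \<and> X o\<^sub>L A \<in> cvs.span ?V + ?P" if "A \<in> J" "X \<in> ?V" for A X
      using V_mult[OF that] span_sub[of ?V] P_sub[of ?V] cvs.span_superset[of ?V] by blast
  qed (use W_J in blast)
  have sub_W: "subideal J (cvs.span ?W + ?P)"
  proof (rule subideal_span_plus[OF J P PJ W_J])
    \<comment> \<open>The additional generators, those in \<open>S\<close>, are sent directly into
      \<open>?V\<close> by multipliers from \<open>J\<close>.\<close>
    fix A X assume A: "A \<in> J" and "X \<in> ?W"
    then have "A o\<^sub>L X \<in> ?V \<union> ?P \<and> X o\<^sub>L A \<in> ?V \<union> ?P"
      using V_mult[OF A] unfolding op_products_def by blast
    then show "A o\<^sub>L X \<in> cvs.span ?W + ?P \<and> X o\<^sub>L A \<in> cvs.span ?W + ?P"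
      using span_sub[of ?W] P_sub[of ?W] cvs.span_superset[of ?W] by blast
  qed
  have "S \<subseteq> cvs.span ?W + ?P"
    using span_sub[of ?W] cvs.span_superset[of ?W] by blast
  then have K_sub_W: "?K \<subseteq> cvs.span ?W + ?P"
    by (rule subideal_gen_smallest(3)[OF J S sub_W])
  have "?W \<subseteq> ?K"
    using SK K by (auto simp: op_products_def subideal_def)
  have spanK: "cvs.span U + ?P \<subseteq> ?K" if "U \<subseteq> ?W" for U
  proof
    fix X assume "X \<in> cvs.span U + ?P"
    then obtain Y Z where "X = Y + Z" "Y \<in> cvs.span U" "Z \<in> ?P"
      by (rule set_plus_elim)
    moreover have "cvs.span U \<subseteq> ?K"
      using that \<open>?W \<subseteq> ?K\<close> by (intro cvs.span_minimal K_sub) (rule order_trans)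
    ultimately show "X \<in> ?K"
      using PK by (auto intro: cvs.subspace_add[OF K_sub])
  qed
  have V_W: "?V \<subseteq> ?W"
    by blast
  \<comment> \<open>The intersection of \<open>?G\<close> with \<open>J\<close> is a
    \<open>J\<close>-ideal containing \<open>S\<close>, so minimality of \<open>?K\<close>
    applies.\<close>
  have KG: "?K \<subseteq> ?G"
  proof -
    have "subideal J (?G \<inter> J)"
      using G J J_BH unfolding BH_ideal_def subideal_def
      by (auto intro: cvs.subspace_inter)
    then show ?thesis
      using subideal_gen_smallest(3)[OF J S] SG S by blast
  qed
  \<comment> \<open>Since \<open>?P\<close> lies in \<open>?K\<close> and \<open>?K\<close> in
    \<open>?G\<close>, equality of the outer two forces all three to agree. If
    \<open>?P = ?K\<close>, then \<open>?P\<close> is a \<open>BH\<close>-ideal containing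
    \<open>S\<close>, so it contains \<open>?G\<close>.\<close>
  have "?P = ?K \<longleftrightarrow> ?P = ?G"
  proof
    assume "?P = ?K"
    then have "?G \<subseteq> ?P"
      using BH_ideal_gen_smallest(3)[OF S_BH P] SK by simp
    then show "?P = ?G"
      using PK KG by blast
  qed (use PK KG in blast)
  then have "?P = ?K \<longleftrightarrow> soft J ?G"
    using triple_product_eq_iff_soft[OF J G] by simp
  then show ?thesis
    using K_sub_W spanK[of ?W, OF subset_refl] spanK[of ?V, OF V_W] P sub_V P_sub[of ?V]
    by (intro conjI equalityI) simp_all
qed

end
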